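(* For $k \ge 2$ and a positive integer $n \equiv 0 \pmod 6$, let $F_1, F_2, \ldots, F_k$ be graphs on a common set of $n$ vertices, each of which is isomorphic to a cycle $C_n$. Then \[ \gamma_{\rm sd}(F_1,F_2,\ldots,F_k) \le \left( 1 - \frac{1}{2} \left( \frac{2}{3} \right)^{k-2} \right) n. \]
   Context: All graphs are finite and simple; $C_n$ is the cycle on $n$ vertices. Given graphs $F_1,\ldots,F_k$ (called factors; not necessarily edge-disjoint) with common vertex set $V$, a set $S \subseteq V$ is a simultaneous dominating set if for every $i$, $1 \le i \le k$, every vertex not in $S$ is adjacent in $F_i$ to some vertex of $S$. The simultaneous domination number $\gamma_{\rm sd}(F_1,\ldots,F_k)$ is the minimum cardinality of a simultaneous dominating set. *)

theory Defs
  imports Complex_Main "Graph_Theory.Pair_Digraph" "Graph_Theory.Digraph_Isomorphism"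
begin

text \<open>
  A finite simple graph is a \<^const>\<open>pair_graph\<close>: a finite, loop-free, symmetric relation
  on a vertex set, each undirected edge being represented by its two orientations.
\<close>

text \<open>The cycle \<open>C_n\<close> on the vertices \<open>0, \<dots>, n - 1\<close>; meaningful for \<open>n \<ge> 3\<close> only.\<close>

definition cycle_graph :: "nat \<Rightarrow> nat pair_pre_digraph" where
  "cycle_graph n =
    \<lparr> pverts = {0..<n},
      parcs = {(i, j). i < n \<and> j < n \<and> (j = (i + 1) mod n \<or> i = (j + 1) mod n)} \<rparr>"

text \<open>The factors on the common vertex set \<open>V\<close> are \<open>F 1, \<dots>, F k\<close>.\<close>

definition simultaneous_dominating_set ::
  "'a set \<Rightarrow> nat \<Rightarrow> (nat \<Rightarrow> 'a pair_pre_digraph) \<Rightarrow> 'a set \<Rightarrow> bool" where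
  "simultaneous_dominating_set V k F S \<longleftrightarrow>
    S \<subseteq> V \<and> (\<forall>i\<in>{1..k}. \<forall>v\<in>V - S. \<exists>u\<in>S. v \<rightarrow>\<^bsub>with_proj (F i)\<^esub> u)"

text \<open>The minimum is over a finite nonempty set whenever \<open>V\<close> is finite, as shown below.\<close>

definition sim_dom_number ::
  "'a set \<Rightarrow> nat \<Rightarrow> (nat \<Rightarrow> 'a pair_pre_digraph) \<Rightarrow> nat" where
  "sim_dom_number V k F = Min (card ` {S. simultaneous_dominating_set V k F S})"

lemma simultaneous_dominating_set_all: "simultaneous_dominating_set V k F V"
  by (simp add: simultaneous_dominating_set_def)

lemma finite_simultaneous_dominating_sets:
  "finite V \<Longrightarrow> finite {S. simultaneous_dominating_set V k F S}"
  by (rule finite_subset[of _ "Pow V"]) (auto simp: simultaneous_dominating_set_def)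

lemma sim_dom_number_le:
  assumes "finite V" "simultaneous_dominating_set V k F S"
  shows "sim_dom_number V k F \<le> card S"
  unfolding sim_dom_number_def
  using assms by (intro Min_le) (auto simp: finite_simultaneous_dominating_sets)

lemma sim_dom_number_attained:
  assumes "finite V"
  obtains S where "simultaneous_dominating_set V k F S" "card S = sim_dom_number V k F"
proof -
  have "sim_dom_number V k F \<in> card ` {S. simultaneous_dominating_set V k F S}"
    unfolding sim_dom_number_def
    using assms simultaneous_dominating_set_all
    by (intro Min_in) (auto simp: finite_simultaneous_dominating_sets)
  then show thesis using that by auto
qed

lemma pair_graph_cycle_graph:
  assumes "n \<ge> 3"
  shows "pair_graph (cycle_graph n)"
proof -
  have "finite (parcs (cycle_graph n))"
    by (rule finite_subset[of _ "{0..<n} \<times> {0..<n}"]) (auto simp: cycle_graph_def)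
  moreover have "i \<noteq> Suc i mod n \<and> Suc i mod n \<noteq> i" if "i < n" for i
    using assms that by (cases "Suc i = n") auto
  ultimately show ?thesis
    by unfold_locales (auto simp: cycle_graph_def symmetric_def sym_def)
qed

text \<open>Between pair digraphs, \<^const>\<open>digraph_iso\<close> is the usual isomorphism of simple graphs.\<close>

lemma digraph_iso_with_proj_iff:
  assumes "pair_wf_digraph G" "pair_wf_digraph H"
  shows "digraph_iso (with_proj G) (with_proj H) \<longleftrightarrow>
    (\<exists>f. bij_betw f (pverts G) (pverts H) \<and>
      (\<forall>u\<in>pverts G. \<forall>v\<in>pverts G. (u, v) \<in> parcs G \<longleftrightarrow> (f u, f v) \<in> parcs H))"
    (is "?L \<longleftrightarrow> ?R")
proof
  interpret G: pair_wf_digraph G by fact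
  assume ?L
  then obtain h where iso: "pre_digraph.digraph_isomorphism (with_proj G) h"
    and H: "with_proj H = app_iso h (with_proj G)"
    by (auto simp: digraph_iso_def)
  define f where "f = iso_verts h"
  have V: "pverts H = f ` pverts G" and A: "parcs H = iso_arcs h ` parcs G"
    and ends: "iso_tail h = fst" "iso_head h = snd"
    using arg_cong[OF H, of verts] arg_cong[OF H, of arcs]
      arg_cong[OF H, of tail] arg_cong[OF H, of head] by (auto simp: f_def)
  have inj: "inj_on f (pverts G)"
    and tl: "\<forall>a\<in>parcs G. f (fst a) = fst (iso_arcs h a) \<and> f (snd a) = snd (iso_arcs h a)"
    using iso by (auto simp: pre_digraph.digraph_isomorphism_def ends f_def)
  have arc: "iso_arcs h (u, v) = (f u, f v)" if "(u, v) \<in> parcs G" for u v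
    using tl that by (metis fst_conv snd_conv prod.collapse)
  have "(u, v) \<in> parcs G \<longleftrightarrow> (f u, f v) \<in> parcs H"
    if uv: "u \<in> pverts G" "v \<in> pverts G" for u v
  proof
    assume "(u, v) \<in> parcs G"
    then show "(f u, f v) \<in> parcs H" using arc A by (metis imageI)
  next
    assume "(f u, f v) \<in> parcs H"
    then obtain x y where xy: "(x, y) \<in> parcs G" "iso_arcs h (x, y) = (f u, f v)"
      using A by auto
    then have "f x = f u" "f y = f v" using arc by auto
    moreover have "x \<in> pverts G" "y \<in> pverts G" using xy G.in_arcsD1 G.in_arcsD2 by auto
    ultimately show "(u, v) \<in> parcs G" using inj uv xy(1) by (metis inj_onD)
  qed
  then show ?R using inj V by (auto simp: bij_betw_def)
next
  interpret G: pair_wf_digraph G by fact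
  interpret H: pair_wf_digraph H by fact
  assume ?R
  then obtain f where f: "bij_betw f (pverts G) (pverts H)"
    and e: "\<And>u v. u \<in> pverts G \<Longrightarrow> v \<in> pverts G \<Longrightarrow> (u, v) \<in> parcs G \<longleftrightarrow> (f u, f v) \<in> parcs H"
    by blast
  define h where
    "h = \<lparr> iso_verts = f, iso_arcs = map_prod f f, iso_head = snd, iso_tail = fst \<rparr>"
  have inj: "inj_on f (pverts G)" and V: "f ` pverts G = pverts H"
    using f by (auto simp: bij_betw_def)
  have "parcs G \<subseteq> pverts G \<times> pverts G"
    using G.in_arcsD1 G.in_arcsD2 by auto
  then have "inj_on (map_prod f f) (parcs G)"
    using inj map_prod_inj_on inj_on_subset by blast
  then have "pre_digraph.digraph_isomorphism (with_proj G) h"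
    using inj G.wf_digraph_axioms
    by (auto simp: pre_digraph.digraph_isomorphism_def h_def)
  moreover have "map_prod f f ` parcs G = parcs H"
  proof
    show "map_prod f f ` parcs G \<subseteq> parcs H"
    proof (rule image_subsetI)
      fix a assume "a \<in> parcs G"
      then show "map_prod f f a \<in> parcs H"
        using e[of "fst a" "snd a"] G.arc_fst_in_verts[of a] G.arc_snd_in_verts[of a]
        by (simp add: map_prod_def split_beta)
    qed
    show "parcs H \<subseteq> map_prod f f ` parcs G"
    proof
      fix a assume a: "a \<in> parcs H"
      obtain x y where xy: "a = (x, y)" by (cases a)
      with a have "x \<in> f ` pverts G" "y \<in> f ` pverts G"
        using H.in_arcsD1[of x y] H.in_arcsD2[of x y] by (simp_all add: V)
      then obtain u v where uv: "u \<in> pverts G" "v \<in> pverts G" "x = f u" "y = f v" by blast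
      then have "(u, v) \<in> parcs G"
        using a xy e[of u v] by simp
      then show "a \<in> map_prod f f ` parcs G"
        using map_prod_imageI[of u v "parcs G" f f] by (simp add: xy uv)
    qed
  qed
  then have "with_proj H = app_iso h (with_proj G)"
    using V by (simp add: app_iso_def h_def with_proj_def)
  ultimately show ?L by (auto simp: digraph_iso_def)
qed

end

(*
  Pass to the complement T of a simultaneous dominating set: no vertex of T may have all its
  neighbours in some factor inside T. For two factors, the alternate edges of each even cycle
  form perfect matchings, and the union of two perfect matchings is bipartite; either colour
  class serves as T and has n/2 vertices. Each further factor is handled by labelling its
  vertices cyclically modulo 3 and removing from T the residue class that meets T least, which
  costs at most a third of T.
*)
theory Submission
  imports Defs
begin

section \<open>Two-colouring the union of two perfect matchings\<close>

text \<open>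
  Contract a pair \<open>{x, a x}\<close> of the first matching, and join the \<open>b\<close>-partners
  of \<open>x\<close> and \<open>a x\<close>: as these receive different colours, so may \<open>x\<close> and \<open>a x\<close>.
\<close>

lemma two_matchings_bipartite:
  assumes "finite V"
    and "\<And>v. v \<in> V \<Longrightarrow> a v \<in> V \<and> a v \<noteq> v \<and> a (a v) = v"
    and "\<And>v. v \<in> V \<Longrightarrow> b v \<in> V \<and> b v \<noteq> v \<and> b (b v) = v"
  obtains T where "T \<subseteq> V" "\<And>v. v \<in> V \<Longrightarrow> a v \<in> T \<longleftrightarrow> v \<notin> T" "\<And>v. v \<in> V \<Longrightarrow> b v \<in> T \<longleftrightarrow> v \<notin> T"
proof -
  have "\<exists>T. \<forall>v\<in>V. (a v \<in> T \<longleftrightarrow> v \<notin> T) \<and> (b v \<in> T \<longleftrightarrow> v \<notin> T)"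
    using assms
  \<comment> \<open>\<open>b\<close> has to vary because the contraction rewires it;
    \<open>a\<close> is only restricted, since deleting one of its pairs leaves a set closed under
    \<open>a\<close>.\<close>
  proof (induction V arbitrary: b rule: finite_psubset_induct)
    case (psubset V)
    note a = psubset.prems(1) and b = psubset.prems(2)
    show ?case
    proof (cases "V = {}")
      case False
      then obtain x where x: "x \<in> V" by blast
      define y where "y = a x"
      define W where "W = V - {x, y}"
      \<comment> \<open>On \<open>W\<close> this differs from \<open>b\<close> only if
        \<open>x\<close> and \<open>y\<close> have their \<open>b\<close>-partners in
        \<open>W\<close>; those two have lost their mates and are now matched to each other.\<close>
      define b' where "b' = (\<lambda>v. if v = b x then b y else if v = b y then b x else b v)"
      have y: "y \<in> V" "y \<noteq> x" "a y = x" using a[OF x] by (auto simp: y_def)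
      have bX: "b x \<in> V" "b x \<noteq> x" "b (b x) = x" using b[OF x] by auto
      have bY: "b y \<in> V" "b y \<noteq> y" "b (b y) = y" using b[OF y(1)] by auto
      have "W \<subset> V" using x by (auto simp: W_def)
      moreover have "a v \<in> W \<and> a v \<noteq> v \<and> a (a v) = v" if "v \<in> W" for v
      proof -
        have "a v \<noteq> x" "a v \<noteq> y" using a[of v] that y by (auto simp: W_def y_def)
        then show ?thesis using a[of v] that by (auto simp: W_def)
      qed
      moreover have "b' v \<in> W \<and> b' v \<noteq> v \<and> b' (b' v) = v" if v: "v \<in> W" for v
      proof -
        have v': "v \<in> V" "v \<noteq> x" "v \<noteq> y" using v by (auto simp: W_def)
        have bv: "b v \<in> V" "b v \<noteq> v" "b (b v) = v" using b[OF v'(1)] by auto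
        have "b x \<noteq> b y" using bX(3) bY(3) y(2) by auto
        consider "v = b x" | "v = b y" "v \<noteq> b x" | "v \<noteq> b x" "v \<noteq> b y" by blast
        then show ?thesis
        proof cases
          case 1
          then show ?thesis using v' bv bX bY y \<open>b x \<noteq> b y\<close>
            by (auto simp: b'_def W_def)
        next
          case 2
          then show ?thesis using v' bv bX bY y \<open>b x \<noteq> b y\<close>
            by (auto simp: b'_def W_def)
        next
          case 3
          have "b v \<noteq> b x" "b v \<noteq> b y" "b v \<noteq> x" "b v \<noteq> y"
            using 3 v' bv bX bY y by metis+
          then show ?thesis using 3 bv by (auto simp: b'_def W_def)
        qed
      qed
      ultimately obtain T where
        T: "\<forall>v\<in>W. (a v \<in> T \<longleftrightarrow> v \<notin> T) \<and> (b' v \<in> T \<longleftrightarrow> v \<notin> T)"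
        using psubset.IH[of W b'] by blast
      show ?thesis
      proof (cases "b x = y")
        case True
        \<comment> \<open>Here {x, y} is an edge of both matchings and thus a component by itself,
          so its colouring is independent of the rest; \<open>b'\<close> agrees with
          \<open>b\<close> on \<open>W\<close>.\<close>
        define U where "U = (T - {y}) \<union> {x}"
        have "(a v \<in> U \<longleftrightarrow> v \<notin> U) \<and> (b v \<in> U \<longleftrightarrow> v \<notin> U)" if v: "v \<in> V" for v
        proof (cases "v = x \<or> v = y")
          case True
          moreover have "a x = y" "b y = x" using \<open>b x = y\<close> bX by (auto simp: y_def)
          ultimately show ?thesis using \<open>b x = y\<close> y by (elim disjE) (simp_all add: U_def)
        next
          case False
          then have "v \<in> W" using v by (simp add: W_def)
          have "a v \<noteq> x" "a v \<noteq> y" using a[OF v] False y a[OF x] y_def by metis+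
          moreover have "b v \<noteq> x" "b v \<noteq> y" using b[OF v] False bX \<open>b x = y\<close> by auto
          moreover have "b' v = b v" using False \<open>b x = y\<close> bX by (auto simp: b'_def)
          ultimately show ?thesis using bspec[OF T \<open>v \<in> W\<close>] False by (simp add: U_def)
        qed
        then show ?thesis by blast
      next
        case False
        \<comment> \<open>\<open>x\<close> and \<open>y\<close> each take the colour opposite to
          their \<open>b\<close>-partner. The partners are matched by \<open>b'\<close>, hence
          coloured differently, so \<open>x\<close> and \<open>y\<close> differ as well, as
          \<open>a\<close> demands.\<close>
        define U where
          "U = (T - {x, y}) \<union> (if b x \<in> T then {} else {x}) \<union> (if b y \<in> T then {} else {y})"
        have "b y \<noteq> x" using False bY(3) by auto
        have bxW: "b x \<in> W" using bX False by (simp add: W_def)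
        have byW: "b y \<in> W" using bY \<open>b y \<noteq> x\<close> by (simp add: W_def)
        have "b' (b x) = b y" by (simp add: b'_def)
        then have byT: "b y \<in> T \<longleftrightarrow> b x \<notin> T" using bspec[OF T bxW] by simp
        have Ux: "x \<in> U \<longleftrightarrow> b x \<notin> T" and Uy: "y \<in> U \<longleftrightarrow> b y \<notin> T"
          using y(2) by (auto simp: U_def)
        have UW: "v \<in> U \<longleftrightarrow> v \<in> T" if "v \<in> W" for v using that by (auto simp: U_def W_def)
        have "(a v \<in> U \<longleftrightarrow> v \<notin> U) \<and> (b v \<in> U \<longleftrightarrow> v \<notin> U)" if v: "v \<in> V" for v
        proof -
          consider "v = x" | "v = y" | "v \<in> W" using v by (auto simp: W_def)
          then show ?thesis
          proof cases
            case 1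
            then show ?thesis using Ux Uy byT UW[OF bxW] y_def by metis
          next
            case 2
            then show ?thesis using Ux Uy byT UW[OF byW] y(3) by metis
          next
            case 3
            then have v': "v \<noteq> x" "v \<noteq> y" by (auto simp: W_def)
            have "a v \<noteq> x" "a v \<noteq> y" using a[OF v] v' y a[OF x] y_def by metis+
            then have aW: "a v \<in> W" using a[OF v] by (simp add: W_def)
            have "b v \<in> U \<longleftrightarrow> v \<notin> U"
            proof (cases "v = b x \<or> v = b y")
              case True
              then show ?thesis using bX(3) bY(3) Ux Uy UW[OF 3] by metis
            next
              case False
              then have "b v \<noteq> x" "b v \<noteq> y" using b[OF v] by auto
              then have "b v \<in> W" using b[OF v] by (simp add: W_def)
              moreover have "b' v = b v" using False by (simp add: b'_def)
              ultimately show ?thesis using T 3 UW by metis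
            qed
            then show ?thesis using T 3 UW aW by blast
          qed
        qed
        then show ?thesis by blast
      qed
    qed simp
  qed
  then obtain T where "\<forall>v\<in>V. (a v \<in> T \<longleftrightarrow> v \<notin> T) \<and> (b v \<in> T \<longleftrightarrow> v \<notin> T)" by blast
  \<comment> \<open>The induction leaves membership outside \<open>V\<close> unconstrained, hence
    the intersection.\<close>
  then show thesis using that[of "T \<inter> V"] assms(2,3) by auto
qed

text \<open>The involution \<open>a\<close> exchanges \<open>T\<close> and its complement, so the
  two are equinumerous.\<close>

lemma card_colour_class_of_matching:
  assumes "finite V" "T \<subseteq> V"
    and "\<And>v. v \<in> V \<Longrightarrow> a v \<in> V \<and> a (a v) = v"
    and "\<And>v. v \<in> V \<Longrightarrow> a v \<in> T \<longleftrightarrow> v \<notin> T"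
  shows "2 * card T = card V"
proof -
  have "bij_betw a T (V - T)"
    by (rule bij_betw_byWitness[where f' = a]) (use assms in auto)
  then have "card T = card (V - T)" by (rule bij_betw_same_card)
  moreover have "card V = card T + card (V - T)"
    using assms(1,2) card_Diff_subset[of T V] card_mono[of V T] finite_subset[of T V] by auto
  ultimately show ?thesis by simp
qed

section \<open>Matchings and colourings from a cyclic labelling\<close>

lemma cycle_labelling:
  assumes "n \<ge> 3" "pair_graph G" "digraph_iso (with_proj G) (with_proj (cycle_graph n))"
  obtains f where "bij_betw f (pverts G) {0..<n}"
    and "\<And>u v. u \<in> pverts G \<Longrightarrow> v \<in> pverts G \<Longrightarrow> f v = (f u + 1) mod n \<Longrightarrow>
      (u, v) \<in> parcs G \<and> (v, u) \<in> parcs G"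
proof -
  interpret G: pair_graph G by fact
  interpret C: pair_graph "cycle_graph n" using assms(1) by (rule pair_graph_cycle_graph)
  obtain f where f: "bij_betw f (pverts G) (pverts (cycle_graph n))"
    and e: "\<forall>u\<in>pverts G. \<forall>v\<in>pverts G. (u, v) \<in> parcs G \<longleftrightarrow> (f u, f v) \<in> parcs (cycle_graph n)"
    using digraph_iso_with_proj_iff[OF G.pair_wf_digraph_axioms C.pair_wf_digraph_axioms] assms(3)
    by blast
  have f': "bij_betw f (pverts G) {0..<n}" using f by (simp add: cycle_graph_def)
  show thesis
  proof (rule that[OF f'])
    fix u v assume uv: "u \<in> pverts G" "v \<in> pverts G" "f v = (f u + 1) mod n"
    have "f u < n" "f v < n" using uv bij_betwE[OF f'] by auto
    then show "(u, v) \<in> parcs G \<and> (v, u) \<in> parcs G"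
      using e uv by (simp add: cycle_graph_def)
  qed
qed

text \<open>Take every other edge of the cycle, pairing the labels 2j and 2j + 1. As
  \<open>n\<close> is even, the last pair does not run past \<open>n - 1\<close>.\<close>

lemma even_cycle_perfect_matching:
  assumes "n \<ge> 3" "even n" "pair_graph G" "digraph_iso (with_proj G) (with_proj (cycle_graph n))"
  obtains a where "\<And>v. v \<in> pverts G \<Longrightarrow> a v \<in> pverts G \<and> a v \<noteq> v \<and> a (a v) = v"
    and "\<And>v. v \<in> pverts G \<Longrightarrow> (v, a v) \<in> parcs G"
proof -
  obtain f where f: "bij_betw f (pverts G) {0..<n}"
    and e: "\<And>u v. u \<in> pverts G \<Longrightarrow> v \<in> pverts G \<Longrightarrow> f v = (f u + 1) mod n \<Longrightarrow>
      (u, v) \<in> parcs G \<and> (v, u) \<in> parcs G"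
    using cycle_labelling[OF assms(1,3,4)] by blast
  define s where "s i = (if even i then i + 1 else i - 1)" for i :: nat
  define g where "g = inv_into (pverts G) f"
  have s: "s i < n" "s i \<noteq> i" "s (s i) = i" if "i < n" for i
  proof -
    have "even i \<Longrightarrow> Suc i < n" using that \<open>even n\<close> by (metis Suc_lessI even_Suc)
    then show "s i < n" using that by (auto simp: s_def)
    show "s i \<noteq> i" "s (s i) = i" by (auto simp: s_def elim: oddE)
  qed
  have g: "g i \<in> pverts G" "f (g i) = i" if "i < n" for i
    using f that by (auto simp: g_def bij_betw_def intro: inv_into_into f_inv_into_f)
  have f_lt: "f v < n" and gf: "g (f v) = v" if "v \<in> pverts G" for v
    using f that by (auto simp: g_def bij_betw_def)
  show thesis
  proof (rule that[of "\<lambda>v. g (s (f v))"])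
    fix v assume v: "v \<in> pverts G"
    note si = s[OF f_lt[OF v]]
    show "g (s (f v)) \<in> pverts G \<and> g (s (f v)) \<noteq> v \<and> g (s (f (g (s (f v))))) = v"
      using g[OF si(1)] si gf[OF v] by auto
    show "(v, g (s (f v))) \<in> parcs G"
    proof (cases "even (f v)")
      case True
      then have "f (g (s (f v))) = (f v + 1) mod n" using g[OF si(1)] si(1) by (simp add: s_def)
      then show ?thesis using e v g[OF si(1)] by blast
    next
      case False
      \<comment> \<open>For an odd label the partner is the predecessor, so the edge is obtained
        from the partner's side.\<close>
      then have "f v = (f (g (s (f v))) + 1) mod n"
        using g[OF si(1)] f_lt[OF v] by (auto simp: s_def elim: oddE)
      then show ?thesis using e v g[OF si(1)] by blast
    qed
  qed
qed

text \<open>Colour by label modulo 3. Since 3 divides \<open>n\<close>, the pattern closes up around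
  the cycle, and a vertex with its two neighbours shows all three colours; each class is therefore
  dominating.\<close>

lemma cycle_domatic_partition:
  assumes "n \<ge> 3" "3 dvd n" "pair_graph G" "digraph_iso (with_proj G) (with_proj (cycle_graph n))"
  obtains c :: "'a \<Rightarrow> nat" where "\<And>v. c v < 3"
    and "\<And>v r. v \<in> pverts G \<Longrightarrow> r < 3 \<Longrightarrow> c v \<noteq> r \<Longrightarrow> \<exists>u\<in>pverts G. c u = r \<and> (v, u) \<in> parcs G"
proof -
  obtain f where f: "bij_betw f (pverts G) {0..<n}"
    and e: "\<And>u v. u \<in> pverts G \<Longrightarrow> v \<in> pverts G \<Longrightarrow> f v = (f u + 1) mod n \<Longrightarrow>
      (u, v) \<in> parcs G \<and> (v, u) \<in> parcs G"
    using cycle_labelling[OF assms(1,3,4)] by blast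
  show thesis
  proof (rule that[of "\<lambda>v. f v mod 3"])
    fix v and r :: nat assume v: "v \<in> pverts G" and r: "r < 3" "f v mod 3 \<noteq> r"
    have fv: "f v < n" using v f by (auto simp: bij_betw_def)
    define i where "i = (f v + 1) mod n"
    \<comment> \<open>The predecessor of \<open>f v\<close>; adding \<open>n - 1\<close> avoids
      truncated subtraction at label 0.\<close>
    define j where "j = (f v + (n - 1)) mod n"
    have "i < n" "j < n" using \<open>n \<ge> 3\<close> by (auto simp: i_def j_def)
    then obtain u w where u: "u \<in> pverts G" "f u = i" and w: "w \<in> pverts G" "f w = j"
      using f by (auto simp: bij_betw_def) (metis atLeastLessThan_iff imageE le0)
    have jv: "f v = (f w + 1) mod n"
      using \<open>n \<ge> 3\<close> fv by (simp add: w j_def mod_simps)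
    have "f v mod 3 = (f w + 1) mod 3" using jv \<open>3 dvd n\<close> by (metis mod_mod_cancel)
    moreover have "f u mod 3 = (f v + 1) mod 3"
      using \<open>3 dvd n\<close> by (simp add: u i_def mod_mod_cancel)
    moreover have "f v mod 3 < 3" "f w mod 3 < 3" by simp_all
    ultimately have "f u mod 3 = r \<or> f w mod 3 = r"
      using r by (simp add: mod_Suc split: if_splits) linarith+
    moreover have "(v, u) \<in> parcs G" "(v, w) \<in> parcs G"
      using e[of v u] e[of w v] u w v jv by (simp_all add: i_def)
    ultimately show "\<exists>u\<in>pverts G. f u mod 3 = r \<and> (v, u) \<in> parcs G"
      using u(1) w(1) by blast
  qed simp
qed

section \<open>Averaging and induction on the number of factors\<close>

text \<open>If every one of the \<open>m\<close> classes exceeded the average, their sizes would sum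
  to more than \<open>card T\<close>.\<close>

lemma rare_colour:
  fixes c :: "'a \<Rightarrow> nat"
  assumes "finite T" "\<And>v. c v < m" "m > 0"
  obtains r where "r < m" "m * card {v \<in> T. c v = r} \<le> card T"
proof -
  have "\<exists>r<m. m * card {v \<in> T. c v = r} \<le> card T"
  proof (rule ccontr)
    assume "\<not> ?thesis"
    then have "(\<Sum>r<m. card T) < (\<Sum>r<m. m * card {v \<in> T. c v = r})"
      using \<open>m > 0\<close> by (intro sum_strict_mono) auto
    also have "\<dots> = m * card (\<Union>r<m. {v \<in> T. c v = r})"
      using \<open>finite T\<close> by (subst card_UN_disjoint) (auto simp: sum_distrib_left)
    also have "(\<Union>r<m. {v \<in> T. c v = r}) = T" using assms(2) by auto
    finally show False by simp
  qed
  then show thesis using that by blast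
qed

text \<open>In this form the condition visibly passes to subsets of \<open>T\<close>, which is what
  allows \<open>T\<close> to be shrunk factor by factor.\<close>

lemma simultaneous_dominating_set_complement_iff:
  assumes "T \<subseteq> V"
  shows "simultaneous_dominating_set V k F (V - T) \<longleftrightarrow>
    (\<forall>i\<in>{1..k}. \<forall>v\<in>T. \<exists>u\<in>V - T. (v, u) \<in> parcs (F i))"
proof -
  have "V - (V - T) = T" using assms by blast
  then show ?thesis by (simp add: simultaneous_dominating_set_def)
qed

lemma dominating_complement:
  assumes "k \<ge> 2" "n > 0" "n mod 6 = 0" "finite V" "card V = n"
    and "\<And>i. i \<in> {1..k} \<Longrightarrow> pair_graph (F i)"
    and "\<And>i. i \<in> {1..k} \<Longrightarrow> pverts (F i) = V"
    and "\<And>i. i \<in> {1..k} \<Longrightarrow> digraph_iso (with_proj (F i)) (with_proj (cycle_graph n))"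
  shows "\<exists>T\<subseteq>V. 1 / 2 * (2 / 3) ^ (k - 2) * real n \<le> real (card T) \<and>
    simultaneous_dominating_set V k F (V - T)"
proof -
  have n: "n \<ge> 3" "even n" "3 dvd n" using assms(2,3) by presburger+
  from assms(1,6-8) show ?thesis
  proof (induction k rule: dec_induct)
    case base
    note F = base
    obtain a where a: "\<And>v. v \<in> V \<Longrightarrow> a v \<in> V \<and> a v \<noteq> v \<and> a (a v) = v"
      and aF: "\<And>v. v \<in> V \<Longrightarrow> (v, a v) \<in> parcs (F 1)"
      using even_cycle_perfect_matching[OF n(1,2), of "F 1"] F[of 1] by auto
    obtain b where b: "\<And>v. v \<in> V \<Longrightarrow> b v \<in> V \<and> b v \<noteq> v \<and> b (b v) = v"
      and bF: "\<And>v. v \<in> V \<Longrightarrow> (v, b v) \<in> parcs (F 2)"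
      using even_cycle_perfect_matching[OF n(1,2), of "F 2"] F[of 2] by auto
    obtain T where T: "T \<subseteq> V" "\<And>v. v \<in> V \<Longrightarrow> a v \<in> T \<longleftrightarrow> v \<notin> T"
      "\<And>v. v \<in> V \<Longrightarrow> b v \<in> T \<longleftrightarrow> v \<notin> T"
      using two_matchings_bipartite[OF \<open>finite V\<close> a b] by blast
    have "2 * card T = n"
      using card_colour_class_of_matching[OF \<open>finite V\<close> T(1) _ T(2)] a assms(5) by auto
    moreover have "\<exists>u\<in>V - T. (v, u) \<in> parcs (F i)" if "i \<in> {1..2}" "v \<in> T" for i v
    proof -
      have v: "v \<in> V" using that T by blast
      have "i = 1 \<or> i = 2" using that by auto
      \<comment> \<open>The neighbour outside \<open>T\<close> is \<open>a v\<close> for the first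
        factor and \<open>b v\<close> for the second.\<close>
      then show ?thesis using a[OF v] aF[OF v] b[OF v] bF[OF v] T(2,3)[OF v] that by blast
    qed
    ultimately show ?case using T(1)
      by (intro exI[of _ T]) (simp add: simultaneous_dominating_set_complement_iff)
  next
    case (step k)
    obtain T where T: "T \<subseteq> V" "1 / 2 * (2 / 3) ^ (k - 2) * real n \<le> real (card T)"
      "simultaneous_dominating_set V k F (V - T)"
      using step.IH step.prems by force
    obtain c :: "'a \<Rightarrow> nat" where c: "\<And>v. c v < 3"
      and cF: "\<And>v r. v \<in> V \<Longrightarrow> r < 3 \<Longrightarrow> c v \<noteq> r \<Longrightarrow> \<exists>u\<in>V. c u = r \<and> (v, u) \<in> parcs (F (Suc k))"
      using cycle_domatic_partition[OF n(1,3), of "F (Suc k)"] step.prems[of "Suc k"] by auto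
    have "finite T" using T(1) \<open>finite V\<close> finite_subset by blast
    then obtain r where r: "r < 3" "3 * card {v \<in> T. c v = r} \<le> card T"
      using rare_colour[of T c 3] c by auto
    define U where "U = T - {v. c v = r}"
    have "card T = card U + card {v \<in> T. c v = r}"
      using card_Int_Diff[OF \<open>finite T\<close>, of "{v. c v = r}"] by (simp add: U_def Int_def)
    then have "2 * card T \<le> 3 * card U" using r(2) by simp
    then have "2 / 3 * real (card T) \<le> real (card U)" by simp
    \<comment> \<open>Subtraction is truncated; \<open>k\<close> \<ge> 2 ensures that the exponent
      really grows by one.\<close>
    moreover have "1 / 2 * (2 / 3) ^ (Suc k - 2) * real n =
        2 / 3 * (1 / 2 * (2 / 3) ^ (k - 2) * real n)"
      using step.hyps(1) power_Suc[of "2 / 3 :: real" "k - 2"]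
      by (subst Suc_diff_le) (simp_all only: mult_ac)
    ultimately have "1 / 2 * (2 / 3) ^ (Suc k - 2) * real n \<le> real (card U)" using T(2) by linarith
    moreover have "\<exists>u\<in>V - U. (v, u) \<in> parcs (F i)" if iv: "i \<in> {1..Suc k}" "v \<in> U" for i v
    proof (cases "i = Suc k")
      case True
      \<comment> \<open>A vertex of \<open>U\<close> is not coloured \<open>r\<close>, so it has a
        neighbour coloured \<open>r\<close>, and no such vertex remains in \<open>U\<close>.\<close>
      then show ?thesis using cF[of v r] r(1) iv T(1) by (auto simp: U_def)
    next
      case False
      then have "i \<in> {1..k}" "v \<in> T" using iv by (auto simp: U_def)
      then obtain u where "u \<in> V - T" "(v, u) \<in> parcs (F i)"
        using T(3) simultaneous_dominating_set_complement_iff[OF T(1)] by meson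
      \<comment> \<open>For the earlier factors the old neighbour still serves, since
        \<open>U\<close> is contained in \<open>T\<close>.\<close>
      then show ?thesis by (auto simp: U_def)
    qed
    moreover have "U \<subseteq> V" using T(1) by (auto simp: U_def)
    ultimately show ?case
      using simultaneous_dominating_set_complement_iff[OF \<open>U \<subseteq> V\<close>] by meson
  qed
qed

theorem theorem23:
  fixes V :: "'a set" and F :: "nat \<Rightarrow> 'a pair_pre_digraph" and k n :: nat
  assumes "k \<ge> 2"
    and "n > 0" and "n mod 6 = 0"
    and "finite V" and "card V = n"
    and "\<And>i. i \<in> {1..k} \<Longrightarrow> pair_graph (F i)"
    and "\<And>i. i \<in> {1..k} \<Longrightarrow> pverts (F i) = V"
    and "\<And>i. i \<in> {1..k} \<Longrightarrow> digraph_iso (with_proj (F i)) (with_proj (cycle_graph n))"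
  shows "real (sim_dom_number V k F) \<le> (1 - 1 / 2 * (2 / 3) ^ (k - 2)) * real n"
proof -
  have "\<exists>T\<subseteq>V. 1 / 2 * (2 / 3) ^ (k - 2) * real n \<le> real (card T) \<and>
      simultaneous_dominating_set V k F (V - T)"
    by (rule dominating_complement) (fact assms)+
  then obtain T where T: "T \<subseteq> V" "1 / 2 * (2 / 3) ^ (k - 2) * real n \<le> real (card T)"
    "simultaneous_dominating_set V k F (V - T)"
    by metis
  have "real (sim_dom_number V k F) \<le> real (card (V - T))"
    using sim_dom_number_le[OF \<open>finite V\<close> T(3)] by simp
  also have "\<dots> = real n - real (card T)"
    using card_Int_Diff[OF \<open>finite V\<close>, of T] T(1) assms(5) by (simp add: Int_absorb1)
  finally show ?thesis using T(2) by (simp add: left_diff_distrib)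
qed

end
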